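(* There exist constants $c>0$ and $\bar\varepsilon>0$ (independent of $n$) such that for every $n\in\mathbb{N}$ there exists a bounded subset $F$ of $(\mathrm{usc\text{-}fcns}(\mathbb{R}^n),d)$ with $$\log N(F,\varepsilon)\ \ge\ \left(\frac{c}{\varepsilon}\right)^n\log\frac{1}{\varepsilon}\quad\text{for all }\varepsilon\in(0,\bar\varepsilon].$$
   Context: Let $\mathbb{N}=\{1,2,\dots\}$, $\overline{\mathbb{R}}=[-\infty,\infty]$. For $f:\mathbb{R}^n\to\overline{\mathbb{R}}$, $\mathrm{hypo} f=\{(x,\alpha)\in\mathbb{R}^n\times\mathbb{R}: f(x)\ge\alpha\}$, and $\mathrm{usc\text{-}fcns}(\mathbb{R}^n)=\{f:\mathbb{R}^n\to\overline{\mathbb{R}}:\mathrm{hypo} f\text{ is nonempty and closed}\}$. The Attouch–Wets distance on $\mathrm{usc\text{-}fcns}(\mathbb{R}^n)$ is $$d(f,g)=\int_0^\infty d_\rho(f,g)\,e^{-\rho}\,d\rho,\qquad d_\rho(f,g)=\max_{z\in\mathbb{R}^n\times\mathbb{R},\ \|z\|_\infty\le\rho}\big|\mathrm{dist}_\infty(z,\mathrm{hypo} f)-\mathrm{dist}_\infty(z,\mathrm{hypo} g)\big|,$$ where $\mathrm{dist}_\infty(z,A)=\inf_{a\in A}\|z-a\|_\infty$. It is a metric; boundedness of $F$ is with respect to $d$. The covering number $N(F,\varepsilon)$ is the smallest number of closed $d$-balls $\{g\in\mathrm{usc\text{-}fcns}(\mathbb{R}^n): d(f_0,g)\le\varepsilon\}$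 of radius $\varepsilon$ (with centers $f_0\in\mathrm{usc\text{-}fcns}(\mathbb{R}^n)$) needed to cover $F$. *)

theory Defs
  imports "HOL-Analysis.Analysis"
begin

text \<open>
  The dimension \<open>n\<close> is quantified inside the statement, so \<open>\<real>\<^sup>n\<close> is the library's
  \<^const>\<open>Euclidean_space\<close> \<open>n\<close>, whose points are the sequences \<open>x\<close> with \<open>x i = 0\<close> for all \<open>i \<ge> n\<close>.
  A function on \<open>\<real>\<^sup>n\<close> is represented by its extension by \<^const>\<open>undefined\<close> outside \<open>\<real>\<^sup>n\<close>
  (\<^const>\<open>extensional\<close>); this makes the representation unique, as is needed for
  the Attouch-Wets distance to be a metric.
\<close>

definition hypo :: "nat \<Rightarrow> ((nat \<Rightarrow> real) \<Rightarrow> ereal) \<Rightarrow> ((nat \<Rightarrow> real) \<times> real) set" where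
  "hypo n f = {(x, \<alpha>). x \<in> topspace (Euclidean_space n) \<and> f x \<ge> ereal \<alpha>}"

definition usc_fcns :: "nat \<Rightarrow> ((nat \<Rightarrow> real) \<Rightarrow> ereal) set" where
  "usc_fcns n = {f \<in> extensional (topspace (Euclidean_space n)).
     hypo n f \<noteq> {} \<and> closedin (prod_topology (Euclidean_space n) euclideanreal) (hypo n f)}"

definition norm_inf :: "nat \<Rightarrow> (nat \<Rightarrow> real) \<times> real \<Rightarrow> real" where
  "norm_inf n z = Max (insert \<bar>snd z\<bar> ((\<lambda>i. \<bar>fst z i\<bar>) ` {..<n}))"

definition dist_inf :: "nat \<Rightarrow> (nat \<Rightarrow> real) \<times> real \<Rightarrow> ((nat \<Rightarrow> real) \<times> real) set \<Rightarrow> real" where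
  "dist_inf n z A = (INF a\<in>A. norm_inf n (\<lambda>i. fst z i - fst a i, snd z - snd a))"

text \<open>
  For \<open>\<rho> \<ge> 0\<close> and nonempty hypographs the supremum is that of a continuous function over a
  nonempty compact set, so it is finite and a maximum.
\<close>

definition aw_dist_at :: "nat \<Rightarrow> real \<Rightarrow> ((nat \<Rightarrow> real) \<Rightarrow> ereal) \<Rightarrow> ((nat \<Rightarrow> real) \<Rightarrow> ereal) \<Rightarrow> real" where
  "aw_dist_at n \<rho> f g =
     (SUP z\<in>{z \<in> topspace (Euclidean_space n) \<times> UNIV. norm_inf n z \<le> \<rho>}.
        \<bar>dist_inf n z (hypo n f) - dist_inf n z (hypo n g)\<bar>)"

definition aw_dist :: "nat \<Rightarrow> ((nat \<Rightarrow> real) \<Rightarrow> ereal) \<Rightarrow> ((nat \<Rightarrow> real) \<Rightarrow> ereal) \<Rightarrow> real" where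
  "aw_dist n f g = (LBINT \<rho>:{0..}. aw_dist_at n \<rho> f g * exp (- \<rho>))"

text \<open>
  The covering number is \<open>\<infinity>\<close> when there is no finite cover. For a bounded \<open>F\<close> in the
  Attouch-Wets metric this does not occur, because bounded sets there are totally bounded.
\<close>

definition covering_number :: "'a set \<Rightarrow> ('a \<Rightarrow> 'a \<Rightarrow> real) \<Rightarrow> 'a set \<Rightarrow> real \<Rightarrow> enat" where
  "covering_number M d F \<epsilon> =
     (INF C\<in>{C. finite C \<and> C \<subseteq> M \<and> F \<subseteq> (\<Union>f\<^sub>0\<in>C. Metric_space.mcball M d f\<^sub>0 \<epsilon>)}. enat (card C))"

definition ln_enat :: "enat \<Rightarrow> ereal" where
  "ln_enat N = (case N of enat k \<Rightarrow> if k = 0 then - \<infinity> else ereal (ln (real k)) | \<infinity> \<Rightarrow> \<infinity>)"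

end

theory Submission
  imports Defs "HOL-Real_Asymp.Real_Asymp"
begin

text \<open>
  Take \<open>F\<close> to be the functions that are nonnegative at the origin. Let \<open>\<delta> = 7\<epsilon>\<close> and consider the
  functions that take values in \<open>{0, \<delta>, 2\<delta>, \<dots>} \<inter> [0, 1]\<close> on the grid of mesh \<open>\<delta>\<close> in \<open>[0, 1]\<^sup>n\<close>
  and are \<open>- \<infinity>\<close> elsewhere. If two of them differ at \<open>x\<close>, the higher tip over \<open>x\<close> has
  distance at least \<open>\<delta>\<close> from the other hypograph, and it lies in the unit ball, so that
  \<open>d\<^sub>\<rho> \<ge> \<delta>\<close> for all \<open>\<rho> \<ge> 1\<close> and \<open>d \<ge> \<delta> / e > 2\<epsilon>\<close>. With \<open>m > 1 / \<delta>\<close> grid points per axis these are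
  \<open>m ^ m ^ n\<close> functions, no two of them in a common ball of radius \<open>\<epsilon>\<close>.
\<close>

section \<open>The maximum norm and the distance to a set\<close>

lemma norm_inf_le_iff:
  "norm_inf n z \<le> r \<longleftrightarrow> \<bar>snd z\<bar> \<le> r \<and> (\<forall>i<n. \<bar>fst z i\<bar> \<le> r)"
  unfolding norm_inf_def by (subst Max_le_iff) auto

lemma abs_snd_le_norm_inf: "\<bar>snd z\<bar> \<le> norm_inf n z"
  using norm_inf_le_iff[of n z "norm_inf n z"] by simp

lemma abs_fst_le_norm_inf: "i < n \<Longrightarrow> \<bar>fst z i\<bar> \<le> norm_inf n z"
  using norm_inf_le_iff[of n z "norm_inf n z"] by simp

lemma norm_inf_nonneg: "0 \<le> norm_inf n z"
  using abs_snd_le_norm_inf[of z n] by linarith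

lemma norm_inf_diff_le:
  "norm_inf n (\<lambda>i. fst z i - fst a i, snd z - snd a) \<le> norm_inf n z + norm_inf n a"
proof -
  have "\<bar>fst z i - fst a i\<bar> \<le> norm_inf n z + norm_inf n a" if "i < n" for i
    using abs_fst_le_norm_inf[OF that, of z] abs_fst_le_norm_inf[OF that, of a] by linarith
  moreover have "\<bar>snd z - snd a\<bar> \<le> norm_inf n z + norm_inf n a"
    using abs_snd_le_norm_inf[of z n] abs_snd_le_norm_inf[of a n] by linarith
  ultimately show ?thesis
    by (simp add: norm_inf_le_iff)
qed

lemma dist_inf_le:
  assumes "a \<in> A"
  shows "dist_inf n z A \<le> norm_inf n (\<lambda>i. fst z i - fst a i, snd z - snd a)"
  unfolding dist_inf_def using assms
  by (intro cINF_lower bdd_belowI2[of _ 0] norm_inf_nonneg) auto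

lemma dist_inf_ge:
  assumes "A \<noteq> {}" "\<And>a. a \<in> A \<Longrightarrow> r \<le> norm_inf n (\<lambda>i. fst z i - fst a i, snd z - snd a)"
  shows "r \<le> dist_inf n z A"
  unfolding dist_inf_def using assms by (intro cINF_greatest)

text \<open>Both distances lie between 0 and \<open>r + norm_inf n z\<close>, so their difference
  costs this bound only once. The resulting slope 1 in \<open>norm_inf n z\<close> is what
  \<open>aw_dist_at_le\<close> uses.\<close>

lemma abs_dist_inf_diff_le:
  assumes "a \<in> A" "b \<in> B" "norm_inf n a \<le> r" "norm_inf n b \<le> r"
  shows "\<bar>dist_inf n z A - dist_inf n z B\<bar> \<le> r + norm_inf n z"
proof -
  have "0 \<le> dist_inf n z A" "0 \<le> dist_inf n z B"
    using assms by (auto intro!: dist_inf_ge norm_inf_nonneg)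
  moreover have "dist_inf n z A \<le> norm_inf n z + norm_inf n a" "dist_inf n z B \<le> norm_inf n z + norm_inf n b"
    using dist_inf_le[OF assms(1)] dist_inf_le[OF assms(2)] norm_inf_diff_le order_trans by blast+
  ultimately show ?thesis
    using assms(3,4) by linarith
qed

lemma ball_inf_nonempty:
  "0 \<le> \<rho> \<Longrightarrow> {z \<in> topspace (Euclidean_space n) \<times> UNIV. norm_inf n z \<le> \<rho>} \<noteq> {}"
  by (auto simp: topspace_Euclidean_space norm_inf_le_iff intro!: exI[of _ "\<lambda>_. 0"] exI[of _ 0])

text \<open>
  This also covers \<open>A = {}\<close>, where \<^const>\<open>dist_inf\<close> is an unspecified constant: the locale
  \<^locale>\<open>Metric_space\<close> demands nonnegativity of the distance outside the carrier, too.
\<close>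

lemma abs_dist_inf_le:
  obtains r where "0 \<le> r" "\<And>z. \<bar>dist_inf n z A\<bar> \<le> r + norm_inf n z"
proof (cases "A = {}")
  case True
  have "\<bar>dist_inf n z A\<bar> \<le> \<bar>dist_inf n (\<lambda>_. 0, 0) A\<bar> + norm_inf n z" for z
    using norm_inf_nonneg[of n z] by (simp add: dist_inf_def True)
  then show thesis
    using that abs_ge_zero by blast
next
  case False
  then obtain a where a: "a \<in> A" by auto
  have "\<bar>dist_inf n z A\<bar> \<le> norm_inf n a + norm_inf n z" for z
    using dist_inf_le[OF a, of n z] norm_inf_diff_le[of n z a] dist_inf_ge[OF False norm_inf_nonneg, of n z]
    by linarith
  then show thesis
    using that norm_inf_nonneg by blast
qed

text \<open>A cruder bound, with slope 2, that holds for arbitrary sets. It makes the suprema finite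
  and the integrals convergent for all \<open>f\<close> and \<open>g\<close>.\<close>

lemma abs_dist_inf_diff_bound:
  obtains r where "0 \<le> r" "\<And>z. \<bar>dist_inf n z A - dist_inf n z B\<bar> \<le> r + 2 * norm_inf n z"
proof -
  obtain r where r: "0 \<le> r" "\<And>z. \<bar>dist_inf n z A\<bar> \<le> r + norm_inf n z"
    using abs_dist_inf_le by blast
  obtain s where s: "0 \<le> s" "\<And>z. \<bar>dist_inf n z B\<bar> \<le> s + norm_inf n z"
    using abs_dist_inf_le by blast
  have "\<bar>dist_inf n z A - dist_inf n z B\<bar> \<le> r + s + 2 * norm_inf n z" for z
    using r(2)[of z] s(2)[of z] by linarith
  then show thesis
    using that[of "r + s"] r(1) s(1) by auto
qed

section \<open>The distances truncated at radius \<open>\<rho>\<close>\<close>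

lemma bdd_above_aw_dist_at:
  "bdd_above ((\<lambda>z. \<bar>dist_inf n z (hypo n f) - dist_inf n z (hypo n g)\<bar>) `
     {z \<in> topspace (Euclidean_space n) \<times> UNIV. norm_inf n z \<le> \<rho>})"
proof -
  obtain r where r: "\<And>z. \<bar>dist_inf n z (hypo n f) - dist_inf n z (hypo n g)\<bar> \<le> r + 2 * norm_inf n z"
    using abs_dist_inf_diff_bound by blast
  show ?thesis
  proof (rule bdd_aboveI2)
    fix z assume "z \<in> {z \<in> topspace (Euclidean_space n) \<times> UNIV. norm_inf n z \<le> \<rho>}"
    then show "\<bar>dist_inf n z (hypo n f) - dist_inf n z (hypo n g)\<bar> \<le> r + 2 * \<rho>"
      using r[of z] by auto
  qed
qed

lemma aw_dist_at_ge:
  assumes "z \<in> topspace (Euclidean_space n) \<times> UNIV" "norm_inf n z \<le> \<rho>"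
  shows "\<bar>dist_inf n z (hypo n f) - dist_inf n z (hypo n g)\<bar> \<le> aw_dist_at n \<rho> f g"
  unfolding aw_dist_at_def
  by (rule cSUP_upper[OF _ bdd_above_aw_dist_at]) (use assms in simp)

lemma aw_dist_at_le:
  assumes "a \<in> hypo n f" "b \<in> hypo n g" "norm_inf n a \<le> r" "norm_inf n b \<le> r" "0 \<le> \<rho>"
  shows "aw_dist_at n \<rho> f g \<le> r + \<rho>"
  unfolding aw_dist_at_def
proof (rule cSUP_least[OF ball_inf_nonempty[OF assms(5)]])
  fix z assume "z \<in> {z \<in> topspace (Euclidean_space n) \<times> UNIV. norm_inf n z \<le> \<rho>}"
  then show "\<bar>dist_inf n z (hypo n f) - dist_inf n z (hypo n g)\<bar> \<le> r + \<rho>"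
    using abs_dist_inf_diff_le[OF assms(1-4), of z] by auto
qed

lemma aw_dist_at_nonneg:
  assumes "0 \<le> \<rho>"
  shows "0 \<le> aw_dist_at n \<rho> f g"
proof -
  obtain z where "z \<in> topspace (Euclidean_space n) \<times> UNIV" "norm_inf n z \<le> \<rho>"
    using ball_inf_nonempty[OF assms] by blast
  from aw_dist_at_ge[OF this, of f g] show ?thesis by linarith
qed

text \<open>A larger ball admits more test points. This monotonicity later yields measurability in
  \<open>\<rho>\<close>.\<close>

lemma aw_dist_at_mono:
  assumes "0 \<le> \<rho>" "\<rho> \<le> \<sigma>"
  shows "aw_dist_at n \<rho> f g \<le> aw_dist_at n \<sigma> f g"
  unfolding aw_dist_at_def[of n \<rho>]
  by (rule cSUP_least[OF ball_inf_nonempty[OF assms(1)]])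
     (use assms in \<open>auto intro!: aw_dist_at_ge\<close>)

lemma aw_dist_at_triangle:
  assumes "0 \<le> \<rho>"
  shows "aw_dist_at n \<rho> f h \<le> aw_dist_at n \<rho> g f + aw_dist_at n \<rho> g h"
  unfolding aw_dist_at_def[of n \<rho> f]
proof (rule cSUP_least[OF ball_inf_nonempty[OF assms]])
  fix z assume "z \<in> {z \<in> topspace (Euclidean_space n) \<times> UNIV. norm_inf n z \<le> \<rho>}"
  then have z: "z \<in> topspace (Euclidean_space n) \<times> UNIV" "norm_inf n z \<le> \<rho>" by auto
  show "\<bar>dist_inf n z (hypo n f) - dist_inf n z (hypo n h)\<bar> \<le> aw_dist_at n \<rho> g f + aw_dist_at n \<rho> g h"
    using aw_dist_at_ge[OF z, of g f] aw_dist_at_ge[OF z, of g h] by linarith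
qed

section \<open>Integration against the exponential weight\<close>

text \<open>An antiderivative is \<open>- (b + c + c * x) * exp (- x)\<close>, which vanishes at
  infinity. The assumptions make the integrand nonnegative from \<open>a\<close> on.\<close>

lemma has_bochner_integral_affine_exp_tail:
  fixes a b c :: real
  assumes "0 \<le> c" "0 \<le> b + c * a"
  shows "has_bochner_integral lborel (\<lambda>x. indicator {a..} x *\<^sub>R ((b + c * x) * exp (- x)))
    ((b + c + c * a) * exp (- a))"
proof (rule has_bochner_integral_nn_integral)
  have nonneg: "0 \<le> (b + c * x) * exp (- x)" if "a \<le> x" for x
    using assms mult_left_mono[OF that \<open>0 \<le> c\<close>] by auto
  then show "AE x in lborel. 0 \<le> indicat_real {a..} x *\<^sub>R ((b + c * x) * exp (- x))"
    by (auto simp: indicator_def)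
  show "0 \<le> (b + c + c * a) * exp (- a)"
    using assms by auto
  have "(\<integral>\<^sup>+x. ennreal ((b + c * x) * exp (- x)) * indicator {a..} x \<partial>lborel) =
      0 - (- (b + c + c * a) * exp (- a))"
  proof (rule nn_integral_FTC_atLeast)
    show "((\<lambda>x. - (b + c + c * x) * exp (- x)) has_real_derivative (b + c * x) * exp (- x)) (at x)" for x
      by (auto intro!: derivative_eq_intros simp: algebra_simps)
    show "((\<lambda>x. - (b + c + c * x) * exp (- x)) \<longlongrightarrow> 0) at_top"
      by real_asymp
  qed (use nonneg in auto)
  moreover have "ennreal (indicat_real {a..} x *\<^sub>R t) = ennreal t * indicator {a..} x" for x t
    by (simp add: indicator_def)
  moreover have "0 - (- (b + c + c * a) * exp (- a)) = (b + c + c * a) * exp (- a)"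
    by (simp add: algebra_simps)
  ultimately show "(\<integral>\<^sup>+x. ennreal (indicat_real {a..} x *\<^sub>R ((b + c * x) * exp (- x))) \<partial>lborel) =
      ennreal ((b + c + c * a) * exp (- a))"
    by (simp only:)
qed simp

lemma set_integrable_affine_exp_tail:
  fixes a b c :: real
  assumes "0 \<le> c" "0 \<le> b + c * a"
  shows "set_integrable lborel {a..} (\<lambda>x. (b + c * x) * exp (- x))"
  using has_bochner_integral_affine_exp_tail[OF assms]
  unfolding set_integrable_def has_bochner_integral_iff by simp

lemma set_integral_affine_exp_tail:
  fixes a b c :: real
  assumes "0 \<le> c" "0 \<le> b + c * a"
  shows "(LBINT x:{a..}. (b + c * x) * exp (- x)) = (b + c + c * a) * exp (- a)"
  using has_bochner_integral_affine_exp_tail[OF assms]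
  unfolding set_lebesgue_integral_def has_bochner_integral_iff by simp

text \<open>Measurability comes from monotonicity in \<open>\<rho>\<close>, and
  \<open>(r + 2 * \<rho>) * exp (- \<rho>)\<close> is an integrable majorant.\<close>

lemma set_integrable_aw_dist:
  "set_integrable lborel {0..} (\<lambda>\<rho>. aw_dist_at n \<rho> f g * exp (- \<rho>))"
proof -
  obtain r where "0 \<le> r"
    and r: "\<And>z. \<bar>dist_inf n z (hypo n f) - dist_inf n z (hypo n g)\<bar> \<le> r + 2 * norm_inf n z"
    using abs_dist_inf_diff_bound by blast
  \<comment> \<open>For negative \<open>\<rho>\<close> the supremum is over the empty set and tells
    nothing; clamping at 0 gives a function that is monotone on the whole line and agrees on
    \<open>{0..}\<close>.\<close>
  define h where "h \<rho> = aw_dist_at n (max 0 \<rho>) f g" for \<rho>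
  have "mono h"
    unfolding h_def by (intro monoI aw_dist_at_mono) auto
  then have [measurable]: "h \<in> borel_measurable borel"
    by (rule borel_measurable_mono)
  have h: "indicat_real {0..} x *\<^sub>R (h x * exp (- x)) = indicat_real {0..} x *\<^sub>R (aw_dist_at n x f g * exp (- x))" for x
    by (simp add: indicator_def h_def)
  show ?thesis
  proof (rule set_integrable_bound)
    show "set_integrable lborel {0..} (\<lambda>x. (r + 2 * x) * exp (- x))"
      by (rule set_integrable_affine_exp_tail) (use \<open>0 \<le> r\<close> in auto)
    have "(\<lambda>x. indicat_real {0..} x *\<^sub>R (h x * exp (- x))) \<in> borel_measurable lborel"
      by simp
    then show "set_borel_measurable lborel {0..} (\<lambda>\<rho>. aw_dist_at n \<rho> f g * exp (- \<rho>))"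
      unfolding set_borel_measurable_def h .
    have "aw_dist_at n x f g \<le> r + 2 * x" if "0 \<le> x" for x
      unfolding aw_dist_at_def
    proof (rule cSUP_least[OF ball_inf_nonempty[OF that]])
      fix z assume "z \<in> {z \<in> topspace (Euclidean_space n) \<times> UNIV. norm_inf n z \<le> x}"
      then show "\<bar>dist_inf n z (hypo n f) - dist_inf n z (hypo n g)\<bar> \<le> r + 2 * x"
        using r[of z] by auto
    qed
    then show "AE x in lborel. x \<in> {0..} \<longrightarrow>
        norm (aw_dist_at n x f g * exp (- x)) \<le> norm ((r + 2 * x) * exp (- x))"
      using \<open>0 \<le> r\<close> aw_dist_at_nonneg by (auto simp: abs_mult)
  qed
qed

text \<open>Integrating \<open>(r + \<rho>) * exp (- \<rho>)\<close> over \<open>{0..}\<close> gives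
  \<open>r + 1\<close>.\<close>

lemma aw_dist_le:
  assumes "a \<in> hypo n f" "b \<in> hypo n g" "norm_inf n a \<le> r" "norm_inf n b \<le> r"
  shows "aw_dist n f g \<le> r + 1"
proof -
  have "0 \<le> r"
    using norm_inf_nonneg[of n a] assms(3) by linarith
  have "aw_dist n f g \<le> (LBINT x:{0..}. (r + 1 * x) * exp (- x))"
    unfolding aw_dist_def
    by (intro set_integral_mono set_integrable_aw_dist set_integrable_affine_exp_tail)
       (use assms \<open>0 \<le> r\<close> aw_dist_at_le[OF assms] in auto)
  also have "\<dots> = r + 1"
    by (subst set_integral_affine_exp_tail) (use \<open>0 \<le> r\<close> in auto)
  finally show ?thesis .
qed

lemma aw_dist_triangle:
  "aw_dist n f h \<le> aw_dist n g f + aw_dist n g h"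
proof -
  note int = set_integrable_aw_dist[of n g f] set_integrable_aw_dist[of n g h]
  have "aw_dist n f h \<le>
      (LBINT \<rho>:{0..}. aw_dist_at n \<rho> g f * exp (- \<rho>) + aw_dist_at n \<rho> g h * exp (- \<rho>))"
    unfolding aw_dist_def
  proof (rule set_integral_mono)
    fix \<rho> :: real assume "\<rho> \<in> {0..}"
    then have "aw_dist_at n \<rho> f h \<le> aw_dist_at n \<rho> g f + aw_dist_at n \<rho> g h"
      using aw_dist_at_triangle by auto
    then show "aw_dist_at n \<rho> f h * exp (- \<rho>) \<le>
        aw_dist_at n \<rho> g f * exp (- \<rho>) + aw_dist_at n \<rho> g h * exp (- \<rho>)"
      by (simp flip: distrib_right)
  qed (use int set_integrable_aw_dist in auto)
  also have "\<dots> = aw_dist n g f + aw_dist n g h"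
    unfolding aw_dist_def using int by (rule set_integral_add)
  finally show ?thesis .
qed

lemma aw_dist_commute: "aw_dist n f g = aw_dist n g f"
  by (simp add: aw_dist_def aw_dist_at_def abs_minus_commute)

text \<open>The point \<open>z\<close> is a test point for every radius
  \<open>\<rho> \<ge> r\<close>, so the truncated distance is at least \<open>\<delta>\<close>
  there. The weight of \<open>{r..}\<close> is \<open>exp (- r)\<close>, and the part of the
  integral below \<open>r\<close> is nonnegative.\<close>

lemma aw_dist_ge:
  assumes "z \<in> topspace (Euclidean_space n) \<times> UNIV"
    "norm_inf n z \<le> r" "\<bar>dist_inf n z (hypo n f) - dist_inf n z (hypo n g)\<bar> \<ge> \<delta>" "0 \<le> \<delta>"
  shows "\<delta> * exp (- r) \<le> aw_dist n f g"
proof -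
  note int = set_integrable_aw_dist[of n f g]
  have "0 \<le> r"
    using norm_inf_nonneg[of n z] assms(2) by linarith
  have "\<delta> * exp (- r) = (LBINT \<rho>:{r..}. (\<delta> + 0 * \<rho>) * exp (- \<rho>))"
    by (subst set_integral_affine_exp_tail) (use \<open>0 \<le> \<delta>\<close> in auto)
  also have "\<dots> \<le> (LBINT \<rho>:{r..}. aw_dist_at n \<rho> f g * exp (- \<rho>))"
  proof (rule set_integral_mono)
    show "set_integrable lborel {r..} (\<lambda>\<rho>. (\<delta> + 0 * \<rho>) * exp (- \<rho>))"
      by (rule set_integrable_affine_exp_tail) (use \<open>0 \<le> \<delta>\<close> in auto)
    show "set_integrable lborel {r..} (\<lambda>\<rho>. aw_dist_at n \<rho> f g * exp (- \<rho>))"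
      using int by (rule set_integrable_subset) (use \<open>0 \<le> r\<close> in auto)
    show "(\<delta> + 0 * \<rho>) * exp (- \<rho>) \<le> aw_dist_at n \<rho> f g * exp (- \<rho>)" if "\<rho> \<in> {r..}" for \<rho>
      using aw_dist_at_ge[OF assms(1), of \<rho> f g] assms that by simp
  qed
  also have "\<dots> \<le> aw_dist n f g"
    unfolding aw_dist_def set_lebesgue_integral_def
  proof (rule integral_mono)
    show "integrable lborel (\<lambda>\<rho>. indicat_real {r..} \<rho> *\<^sub>R (aw_dist_at n \<rho> f g * exp (- \<rho>)))"
      using set_integrable_subset[OF int, of "{r..}"] \<open>0 \<le> r\<close> by (auto simp: set_integrable_def)
    show "integrable lborel (\<lambda>\<rho>. indicat_real {0..} \<rho> *\<^sub>R (aw_dist_at n \<rho> f g * exp (- \<rho>)))"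
      using int by (simp add: set_integrable_def)
    show "indicat_real {r..} \<rho> *\<^sub>R (aw_dist_at n \<rho> f g * exp (- \<rho>))
        \<le> indicat_real {0..} \<rho> *\<^sub>R (aw_dist_at n \<rho> f g * exp (- \<rho>))" for \<rho>
      using \<open>0 \<le> r\<close> aw_dist_at_nonneg[of \<rho> n f g] by (auto simp: indicator_def)
  qed
  finally show ?thesis .
qed

section \<open>The Attouch-Wets distance is a metric\<close>

text \<open>This links the product topology to the maximum norm: a basic neighbourhood of
  \<open>z\<close> that misses \<open>A\<close> contains all points of the space within some
  positive distance of \<open>z\<close>.\<close>

lemma dist_inf_pos:
  assumes "closedin (prod_topology (Euclidean_space n) euclideanreal) A" "A \<noteq> {}"
    "z \<in> topspace (Euclidean_space n) \<times> UNIV" "z \<notin> A"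
  shows "0 < dist_inf n z A"
proof -
  obtain x \<alpha> where z: "z = (x, \<alpha>)" by force
  have A: "A \<subseteq> topspace (Euclidean_space n) \<times> UNIV"
    using closedin_subset[OF assms(1)] by simp
  have "openin (prod_topology (Euclidean_space n) euclideanreal) (topspace (Euclidean_space n) \<times> UNIV - A)"
    using assms(1) by (simp add: closedin_def)
  then obtain U W where UW: "openin (Euclidean_space n) U" "open W" "x \<in> U" "\<alpha> \<in> W"
      "U \<times> W \<subseteq> topspace (Euclidean_space n) \<times> UNIV - A"
    using assms(3,4) z unfolding openin_prod_topology_alt by (auto simp del: topspace_euclidean) metis
  obtain U' where U': "openin (powertop_real UNIV) U'" "U = U' \<inter> {x. \<forall>i\<ge>n. x i = 0}"
    using UW(1) unfolding Euclidean_space_def openin_subtopology by blast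
  then obtain B where B: "\<And>i. open (B i)" "x \<in> Pi\<^sub>E UNIV B" "Pi\<^sub>E UNIV B \<subseteq> U'"
    using UW(3) unfolding openin_product_topology_alt by fastforce
  have "\<exists>e>0. \<forall>t. \<bar>x i - t\<bar> < e \<longrightarrow> t \<in> B i" for i
    using B(1)[of i] B(2) by (force simp: open_dist dist_real_def abs_minus_commute)
  then obtain e where e: "\<And>i. 0 < e i" "\<And>i t. \<bar>x i - t\<bar> < e i \<Longrightarrow> t \<in> B i"
    by metis
  obtain e' where e': "0 < e'" "\<And>t. \<bar>\<alpha> - t\<bar> < e' \<Longrightarrow> t \<in> W"
    using UW(2,4) by (force simp: open_dist dist_real_def abs_minus_commute)
  \<comment> \<open>Only the first \<open>n\<close> coordinates and the last component need a
    radius, so this is a minimum of finitely many positive numbers.\<close>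
  define \<delta> where "\<delta> = Min (insert e' (e ` {..<n}))"
  have \<delta>: "0 < \<delta>" "\<delta> \<le> e'" "\<And>i. i < n \<Longrightarrow> \<delta> \<le> e i"
    using e(1) e'(1) by (auto simp: \<delta>_def)
  have "\<delta> \<le> dist_inf n z A"
  proof (rule dist_inf_ge[OF assms(2)], rule ccontr)
    fix a assume a: "a \<in> A" "\<not> \<delta> \<le> norm_inf n (\<lambda>i. fst z i - fst a i, snd z - snd a)"
    have "\<bar>\<alpha> - snd a\<bar> < e'"
      using abs_snd_le_norm_inf[of "(\<lambda>i. fst z i - fst a i, snd z - snd a)" n] a \<delta> z by simp
    then have "snd a \<in> W"
      by (rule e')
    moreover have "fst a \<in> topspace (Euclidean_space n)" "x \<in> topspace (Euclidean_space n)"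
      using a A assms(3) z by auto
    moreover have "fst a i \<in> B i" for i
    proof (cases "i < n")
      case True
      then show ?thesis
        using abs_fst_le_norm_inf[of i n "(\<lambda>i. fst z i - fst a i, snd z - snd a)"] a \<delta>(3)[of i] z
        by (intro e) simp
    next
      case False
      \<comment> \<open>Both points lie in the space, so these coordinates are 0.\<close>
      then have "fst a i = x i"
        using calculation by (simp add: topspace_Euclidean_space)
      then show ?thesis
        using B(2) by auto
    qed
    ultimately have "a \<in> U \<times> W"
      using B(3) U'(2) by (auto simp: topspace_Euclidean_space mem_Times_iff)
    then show False
      using UW(5) a(1) by blast
  qed
  with \<delta>(1) show ?thesis by linarith
qed

text \<open>Where the functions differ, a point at a height strictly between the two values belongs
  to one hypograph and has positive distance from the other, which is closed.\<close>

lemma aw_dist_pos: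
  assumes f: "f \<in> usc_fcns n" and g: "g \<in> usc_fcns n" and "f \<noteq> g"
  shows "0 < aw_dist n f g"
proof -
  have *: "0 < aw_dist n f g"
    if f: "f \<in> usc_fcns n" and g: "g \<in> usc_fcns n"
      and x: "x \<in> topspace (Euclidean_space n)" "g x < f x" for f g x
  proof -
    obtain \<alpha> where \<alpha>: "g x < ereal \<alpha>" "ereal \<alpha> < f x"
      using ereal_dense2[OF x(2)] by blast
    let ?z = "(x, \<alpha>)"
    have "?z \<in> hypo n f" "?z \<notin> hypo n g"
      using \<alpha> x by (auto simp: hypo_def)
    moreover from this have "0 < dist_inf n ?z (hypo n g)"
      using g x by (intro dist_inf_pos) (auto simp: usc_fcns_def)
    moreover have "dist_inf n ?z (hypo n f) \<le> 0"
      using \<open>?z \<in> hypo n f\<close> by (intro dist_inf_le[THEN order_trans]) (auto simp: norm_inf_le_iff)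
    ultimately have "0 < dist_inf n ?z (hypo n g) * exp (- norm_inf n ?z)"
      "dist_inf n ?z (hypo n g) * exp (- norm_inf n ?z) \<le> aw_dist n f g"
      using x by (auto intro!: aw_dist_ge[of ?z])
    then show ?thesis by linarith
  qed
  obtain x where x: "f x \<noteq> g x"
    using \<open>f \<noteq> g\<close> by (metis ext)
  \<comment> \<open>Outside the space both functions are \<open>undefined\<close>, hence
    equal.\<close>
  then have "x \<in> topspace (Euclidean_space n)"
    using f g by (auto simp: usc_fcns_def extensional_def)
  then show ?thesis
    using *[OF f g, of x] *[OF g f, of x] x aw_dist_commute[of n f g] by (cases "f x" "g x" rule: linorder_cases) auto
qed

lemma aw_dist_self: "aw_dist n f f = 0"
proof -
  have "aw_dist_at n \<rho> f f = 0" if "0 \<le> \<rho>" for \<rho>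
    using ball_inf_nonempty[OF that, of n] by (simp add: aw_dist_at_def)
  then have "indicat_real {0..} \<rho> *\<^sub>R (aw_dist_at n \<rho> f f * exp (- \<rho>)) = 0" for \<rho>
    by (simp add: indicator_def)
  then show ?thesis
    unfolding aw_dist_def set_lebesgue_integral_def by (simp only: Bochner_Integration.integral_zero)
qed

lemma Metric_space_aw_dist: "Metric_space (usc_fcns n) (aw_dist n)"
proof
  show "0 \<le> aw_dist n f g" for f g
    unfolding aw_dist_def set_lebesgue_integral_def
    by (intro Bochner_Integration.integral_nonneg) (auto simp: indicator_def aw_dist_at_nonneg)
  show "aw_dist n f g = aw_dist n g f" for f g
    by (rule aw_dist_commute)
  show "aw_dist n f g = 0 \<longleftrightarrow> f = g" if "f \<in> usc_fcns n" "g \<in> usc_fcns n" for f g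
    using aw_dist_pos[OF that] aw_dist_self by force
  show "aw_dist n f h \<le> aw_dist n f g + aw_dist n g h" for f g h
    using aw_dist_triangle[of n f h g] by (simp add: aw_dist_commute[of n f g])
qed

section \<open>Functions that are finite only on a given set\<close>

definition spikes :: "nat \<Rightarrow> (nat \<Rightarrow> real) set \<Rightarrow> ((nat \<Rightarrow> real) \<Rightarrow> real) \<Rightarrow> (nat \<Rightarrow> real) \<Rightarrow> ereal" where
  "spikes n S v = restrict (\<lambda>x. if x \<in> S then ereal (v x) else - \<infinity>) (topspace (Euclidean_space n))"

lemma hypo_spikes:
  "S \<subseteq> topspace (Euclidean_space n) \<Longrightarrow> hypo n (spikes n S v) = (\<Union>x\<in>S. {x} \<times> {..v x})"
  by (auto simp: hypo_def spikes_def split: if_splits)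

text \<open>The hypograph is a finite union of downward half-lines over points, and points are
  closed in a Hausdorff space.\<close>

lemma spikes_in_usc_fcns:
  assumes "finite S" "S \<noteq> {}" "S \<subseteq> topspace (Euclidean_space n)"
  shows "spikes n S v \<in> usc_fcns n"
proof -
  have "closedin (prod_topology (Euclidean_space n) euclideanreal) (\<Union>x\<in>S. {x} \<times> {..v x})"
    using assms
    by (intro closedin_Union) (auto simp: closedin_prod_Times_iff Hausdorff_Euclidean_space
      intro!: closedin_Hausdorff_singleton)
  then show ?thesis
    using assms unfolding usc_fcns_def by (auto simp: hypo_spikes) (auto simp: spikes_def)
qed

text \<open>The test point is the higher of the two tips over \<open>x\<close>. In the other
  hypograph, the half-line over \<open>x\<close> ends at least \<open>\<delta>\<close> below it, and
  all other half-lines are at least \<open>\<delta>\<close> away horizontally.\<close>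

lemma aw_dist_spikes_ge:
  assumes S: "S \<subseteq> topspace (Euclidean_space n)"
    and x: "x \<in> S" "v x \<noteq> w x"
    and le: "norm_inf n (x, v x) \<le> r" "norm_inf n (x, w x) \<le> r"
    and sep: "\<And>y. y \<in> S \<Longrightarrow> y \<noteq> x \<Longrightarrow> \<exists>i<n. \<delta> \<le> \<bar>x i - y i\<bar>" "\<delta> \<le> \<bar>v x - w x\<bar>"
    and "0 \<le> \<delta>"
  shows "\<delta> * exp (- r) \<le> aw_dist n (spikes n S v) (spikes n S w)"
proof -
  note hypo = hypo_spikes[OF S]
  have ne: "hypo n (spikes n S u) \<noteq> {}" for u
    using x by (auto simp: hypo)
  \<comment> \<open>The case where \<open>v\<close> has the higher tip. The lower tip would not
    serve, since it lies in both hypographs.\<close>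
  have *: "\<delta> * exp (- r) \<le> aw_dist n (spikes n S v) (spikes n S w)"
    if le: "norm_inf n (x, v x) \<le> r" and gt: "w x < v x" "\<delta> \<le> \<bar>v x - w x\<bar>" for v w
  proof (rule aw_dist_ge[OF _ le])
    have "dist_inf n (x, v x) (hypo n (spikes n S v)) \<le> 0"
      using x by (intro dist_inf_le[of "(x, v x)", THEN order_trans]) (auto simp: hypo norm_inf_le_iff)
    moreover have "\<delta> \<le> dist_inf n (x, v x) (hypo n (spikes n S w))"
    proof (rule dist_inf_ge[OF ne])
      fix a assume "a \<in> hypo n (spikes n S w)"
      then obtain y \<beta> where a: "a = (y, \<beta>)" "y \<in> S" "\<beta> \<le> w y"
        by (auto simp: hypo)
      let ?d = "(\<lambda>i. x i - y i, v x - \<beta>)"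
      have "\<delta> \<le> norm_inf n ?d"
      proof (cases "y = x")
        case True
        then show ?thesis
          using abs_snd_le_norm_inf[of ?d n] a gt by simp
      next
        case False
        then obtain i where "i < n" "\<delta> \<le> \<bar>x i - y i\<bar>"
          using sep(1) a by blast
        then show ?thesis
          using abs_fst_le_norm_inf[of i n ?d] by simp
      qed
      then show "\<delta> \<le> norm_inf n (\<lambda>i. fst (x, v x) i - fst a i, snd (x, v x) - snd a)"
        using a by simp
    qed
    ultimately show "\<delta> \<le> \<bar>dist_inf n (x, v x) (hypo n (spikes n S v)) -
        dist_inf n (x, v x) (hypo n (spikes n S w))\<bar>"
      by linarith
  qed (use S x \<open>0 \<le> \<delta>\<close> in auto)
  show ?thesis
  proof (cases "w x < v x")
    case True
    then show ?thesis using * le sep by blast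
  next
    case False
    then show ?thesis
      using *[of w v] le sep x by (subst aw_dist_commute) (auto simp: abs_minus_commute)
  qed
qed

section \<open>Counting and packing\<close>

lemma card_grid:
  fixes V :: "'a::zero set" and n :: nat
  assumes "finite V"
  defines "G \<equiv> {x. (\<forall>i<n. x i \<in> V) \<and> (\<forall>i\<ge>n. x i = 0)}"
  shows "finite G" "card G = card V ^ n"
proof -
  have "bij_betw (\<lambda>x. restrict x {..<n}) G ({..<n} \<rightarrow>\<^sub>E V)"
    by (rule bij_betwI[where g = "\<lambda>y i. if i < n then y i else 0"])
       (auto simp: G_def fun_eq_iff PiE_def extensional_def Pi_def)
  then show "finite G" "card G = card V ^ n"
    using assms by (simp_all add: bij_betw_finite finite_PiE card_PiE bij_betw_same_card)
qed

text \<open>Two points in a common closed ball of radius \<open>\<epsilon>\<close> are at most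
  \<open>2 * \<epsilon>\<close> apart, so choosing a ball for each point of \<open>P\<close> is
  injective. If there is no finite cover, the infimum is \<open>\<infinity>\<close> and the bound is
  trivial.\<close>

lemma (in Metric_space) covering_number_ge_card_packing:
  assumes "P \<subseteq> F" "finite P" "P \<subseteq> M"
    and sep: "\<And>p q. p \<in> P \<Longrightarrow> q \<in> P \<Longrightarrow> p \<noteq> q \<Longrightarrow> 2 * \<epsilon> < d p q"
  shows "enat (card P) \<le> covering_number M d F \<epsilon>"
  unfolding covering_number_def
proof (rule INF_greatest)
  fix C assume "C \<in> {C. finite C \<and> C \<subseteq> M \<and> F \<subseteq> (\<Union>f\<^sub>0\<in>C. mcball f\<^sub>0 \<epsilon>)}"
  then have C: "finite C" "C \<subseteq> M" "F \<subseteq> (\<Union>f\<^sub>0\<in>C. mcball f\<^sub>0 \<epsilon>)"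
    by auto
  have "\<exists>g\<in>C. d g p \<le> \<epsilon>" if "p \<in> P" for p
    using subsetD[OF C(3), of p] subsetD[OF assms(1) that] by auto
  then obtain c where c: "\<And>p. p \<in> P \<Longrightarrow> c p \<in> C \<and> d (c p) p \<le> \<epsilon>"
    by metis
  have "inj_on c P"
  proof (rule inj_onI, rule ccontr)
    fix p q assume pq: "p \<in> P" "q \<in> P" "c p = c q" "p \<noteq> q"
    then have "d p q \<le> d (c p) p + d (c p) q"
      using triangle[of p "c p" q] commute[of p "c p"] assms(3) C(2) c by auto
    then show False
      using sep[of p q] c[of p] c[of q] pq by auto
  qed
  then have "card P \<le> card C"
    using c C(1) by (intro card_inj_on_le[of c]) auto
  then show "enat (card P) \<le> enat (card C)"
    by simp
qed

lemma ln_enat_ge: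
  assumes "enat k \<le> N" "0 < k"
  shows "ereal (ln (real k)) \<le> ln_enat N"
  using assms by (cases N) (auto simp: ln_enat_def)

text \<open>Here \<open>m\<close> is the number of multiples of \<open>7 * \<epsilon>\<close> in
  [0, 1], counting 0. The packing assigns one of \<open>m\<close> values to each of the
  \<open>m ^ n\<close> grid points.\<close>

lemma covering_number_usc_fcns_ge:
  assumes \<epsilon>: "0 < \<epsilon>"
  defines "m \<equiv> Suc (nat \<lfloor>1 / (7 * \<epsilon>)\<rfloor>)"
  shows "enat (m ^ m ^ n) \<le> covering_number (usc_fcns n) (aw_dist n)
     {f \<in> usc_fcns n. 0 \<le> f (\<lambda>_. 0)} \<epsilon>"
proof -
  \<comment> \<open>The factor 7 exceeds \<open>2 * exp 1\<close>, so that
    \<open>\<delta> * exp (- 1)\<close> is more than \<open>2 * \<epsilon>\<close>.\<close>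
  define \<delta> where "\<delta> = 7 * \<epsilon>"
  have "0 < \<delta>"
    using \<epsilon> by (simp add: \<delta>_def)
  \<comment> \<open>The same set serves for the grid coordinates and for the function values, so one
    separation bound covers both directions.\<close>
  define V where "V = (\<lambda>k. \<delta> * real k) ` {..<m}"
  have fin: "finite V" and card: "card V = m"
    unfolding V_def using \<open>0 < \<delta>\<close> by (auto intro!: card_image[THEN trans] inj_onI)
  have V_bounds: "0 \<le> t \<and> t \<le> 1" if t: "t \<in> V" for t
  proof -
    obtain k where k: "k < m" "t = \<delta> * real k"
      using t unfolding V_def by (elim imageE) simp
    have "int k \<le> \<lfloor>1 / \<delta>\<rfloor>"
      using k(1) \<open>0 < \<delta>\<close> by (simp add: m_def \<delta>_def less_Suc_eq_le le_nat_iff)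
    then have "real k \<le> 1 / \<delta>"
      by (simp add: le_floor_iff)
    then show ?thesis
      using \<open>0 < \<delta>\<close> k by (simp add: field_simps)
  qed
  have V_sep: "\<delta> \<le> \<bar>s - t\<bar>" if st: "s \<in> V" "t \<in> V" "s \<noteq> t" for s t
  proof -
    obtain k l where kl: "s = \<delta> * real k" "t = \<delta> * real l"
      using st by (auto simp: V_def)
    then have "1 \<le> \<bar>real k - real l\<bar>"
      using st by auto
    then have "\<delta> * 1 \<le> \<delta> * \<bar>real k - real l\<bar>"
      using \<open>0 < \<delta>\<close> by (intro mult_left_mono) auto
    also have "\<dots> = \<bar>s - t\<bar>"
      using \<open>0 < \<delta>\<close> by (simp add: kl abs_mult flip: right_diff_distrib)
    finally show ?thesis by simp
  qed
  define S where "S = {x. (\<forall>i<n. x i \<in> V) \<and> (\<forall>i\<ge>n. x i = 0)}"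
  have S: "finite S" "card S = m ^ n" "S \<subseteq> topspace (Euclidean_space n)"
    using card_grid[OF fin, of n] card by (auto simp: S_def topspace_Euclidean_space)
  have "0 \<in> V"
    by (auto simp: V_def m_def intro!: image_eqI[of _ _ 0])
  then have zero: "(\<lambda>_. 0) \<in> S"
    by (simp add: S_def)
  \<comment> \<open>Extensional \<open>v\<close> are determined by their values on \<open>S\<close>,
    which makes \<open>spikes n S\<close> injective here.\<close>
  define P where "P = spikes n S ` (S \<rightarrow>\<^sub>E V)"
  have far: "2 * \<epsilon> < aw_dist n (spikes n S v) (spikes n S w)"
    if v: "v \<in> S \<rightarrow>\<^sub>E V" and w: "w \<in> S \<rightarrow>\<^sub>E V" and ne: "v \<noteq> w" for v w
  proof -
    obtain x where x: "x \<in> S" "v x \<noteq> w x"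
      using PiE_ext[OF v w] ne by blast
    have "norm_inf n (x, u x) \<le> 1" if "u \<in> S \<rightarrow>\<^sub>E V" for u
    proof -
      have "\<bar>t\<bar> \<le> 1" if "t \<in> V" for t
        using V_bounds[OF that] by simp
      moreover have "u x \<in> V" "\<forall>i<n. x i \<in> V"
        using that x by (auto simp: S_def)
      ultimately show ?thesis
        by (simp add: norm_inf_le_iff)
    qed
    moreover have "\<exists>i<n. \<delta> \<le> \<bar>x i - y i\<bar>" if "y \<in> S" "y \<noteq> x" for y
    proof -
      obtain i where i: "x i \<noteq> y i"
        using \<open>y \<noteq> x\<close> by (metis ext)
      moreover have "i < n"
        using i x that by (cases "i < n") (auto simp: S_def)
      moreover have "x i \<in> V" "y i \<in> V"
        using \<open>i < n\<close> x that by (auto simp: S_def)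
      ultimately show ?thesis
        using V_sep by blast
    qed
    moreover have "\<delta> \<le> \<bar>v x - w x\<bar>"
      using x v w by (intro V_sep) auto
    ultimately have "\<delta> * exp (- 1) \<le> aw_dist n (spikes n S v) (spikes n S w)"
      using x v w S \<open>0 < \<delta>\<close> by (intro aw_dist_spikes_ge[of S n x v w]) auto
    moreover have "2 * \<epsilon> < \<delta> * exp (- 1)"
      using exp_le \<epsilon> by (simp add: \<delta>_def exp_minus field_simps)
    ultimately show ?thesis
      by linarith
  qed
  have inj: "inj_on (spikes n S) (S \<rightarrow>\<^sub>E V)"
  proof (rule inj_onI)
    fix v w assume vw: "v \<in> S \<rightarrow>\<^sub>E V" "w \<in> S \<rightarrow>\<^sub>E V" "spikes n S v = spikes n S w"
    have "v x = w x" if "x \<in> S" for x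
      using fun_cong[OF vw(3), of x] that S(3) by (auto simp: spikes_def subset_iff)
    with vw(1,2) show "v = w"
      by (rule PiE_ext)
  qed
  have "card P = m ^ m ^ n" "finite P"
    using S fin card by (simp_all add: P_def card_image[OF inj] card_PiE finite_PiE)
  moreover have "P \<subseteq> {f \<in> usc_fcns n. 0 \<le> f (\<lambda>_. 0)}"
  proof -
    have "0 \<le> spikes n S v (\<lambda>_. 0)" if "v \<in> S \<rightarrow>\<^sub>E V" for v
      using zero S V_bounds that by (auto simp: spikes_def subset_iff)
    then show ?thesis
      using S zero by (auto simp: P_def intro!: spikes_in_usc_fcns)
  qed
  moreover have "2 * \<epsilon> < aw_dist n p q" if "p \<in> P" "q \<in> P" "p \<noteq> q" for p q
    using that far by (auto simp: P_def)
  ultimately show ?thesis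
    using Metric_space.covering_number_ge_card_packing[OF Metric_space_aw_dist[of n],
      of P "{f \<in> usc_fcns n. 0 \<le> f (\<lambda>_. 0)}" \<epsilon>] by auto
qed

theorem theorem4p4:
  shows "\<exists>(c::real) (\<epsilon>bar::real). c > 0 \<and> \<epsilon>bar > 0 \<and>
    (\<forall>n::nat. n \<ge> 1 \<longrightarrow>
      (\<exists>F. F \<subseteq> usc_fcns n \<and> Metric_space.mbounded (usc_fcns n) (aw_dist n) F \<and>
        (\<forall>\<epsilon>\<in>{0<..\<epsilon>bar}.
          ln_enat (covering_number (usc_fcns n) (aw_dist n) F \<epsilon>)
            \<ge> ereal ((c / \<epsilon>) ^ n * ln (1 / \<epsilon>)))))"
\<comment> \<open>In 1/14, the factor 1/7 comes from the mesh \<open>7 * \<epsilon>\<close> and 1/2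
  pays for replacing \<open>ln (real m)\<close> by half of \<open>ln (1 / \<epsilon>)\<close>. The
  bound 1/49 makes \<open>1 / \<epsilon>\<close> at most the square of
  \<open>1 / (7 * \<epsilon>)\<close>.\<close>
proof (rule exI[of _ "1/14"], rule exI[of _ "1/49"], intro conjI allI impI)
  fix n :: nat assume n: "n \<ge> 1"
  define F where "F = {f \<in> usc_fcns n. 0 \<le> f (\<lambda>_. 0)}"
  \<comment> \<open>All hypographs of members of \<open>F\<close> contain the origin, which has norm
    0.\<close>
  have "aw_dist n f g \<le> 1" if "f \<in> F" "g \<in> F" for f g
    using that aw_dist_le[of "(\<lambda>_. 0, 0)" n f "(\<lambda>_. 0, 0)" g 0]
    by (simp add: F_def hypo_def norm_inf_le_iff topspace_Euclidean_space zero_ereal_def)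
  then have bounded: "Metric_space.mbounded (usc_fcns n) (aw_dist n) F"
    unfolding Metric_space.mbounded_def[OF Metric_space_aw_dist]
      Metric_space.mcball_def[OF Metric_space_aw_dist] F_def by blast
  have "ereal ((1/14 / \<epsilon>) ^ n * ln (1 / \<epsilon>)) \<le> ln_enat (covering_number (usc_fcns n) (aw_dist n) F \<epsilon>)"
    if "\<epsilon> \<in> {0<..1/49}" for \<epsilon>
  proof -
    have \<epsilon>: "0 < \<epsilon>" "\<epsilon> \<le> 1/49"
      using that by auto
    define m where "m = Suc (nat \<lfloor>1 / (7 * \<epsilon>)\<rfloor>)"
    have m: "1 / (7 * \<epsilon>) \<le> real m"
      unfolding m_def using \<epsilon> by linarith
    have "1 / \<epsilon> \<le> (1 / (7 * \<epsilon>))\<^sup>2"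
      using \<epsilon> by (simp add: field_simps power2_eq_square)
    also have "\<dots> \<le> (real m)\<^sup>2"
      using m \<epsilon> by (intro power_mono) auto
    finally have "ln (1 / \<epsilon>) \<le> ln ((real m)\<^sup>2)"
      using \<epsilon> by (subst ln_le_cancel_iff) (auto simp: m_def)
    then have ln: "1/2 * ln (1 / \<epsilon>) \<le> ln (real m)"
      by (simp add: ln_realpow m_def)
    \<comment> \<open>Since \<open>n \<ge> 1\<close>, the factor \<open>(1/2) ^ n\<close> is at most
      1/2, which is all that the logarithm requires.\<close>
    have "(1/14 / \<epsilon>) ^ n = (1/2) ^ n * (1 / (7 * \<epsilon>)) ^ n"
      by (simp flip: power_mult_distrib)
    also have "\<dots> \<le> 1/2 * real m ^ n"
      using n m \<epsilon> power_decreasing[OF n, of "1/2::real"] by (intro mult_mono power_mono) auto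
    finally have "(1/14 / \<epsilon>) ^ n * ln (1 / \<epsilon>) \<le> 1/2 * real m ^ n * ln (1 / \<epsilon>)"
      using \<epsilon> by (intro mult_right_mono) auto
    also have "\<dots> = real m ^ n * (1/2 * ln (1 / \<epsilon>))"
      by simp
    also have "\<dots> \<le> real m ^ n * ln (real m)"
      using ln by (intro mult_left_mono) auto
    also have "\<dots> = ln (real (m ^ m ^ n))"
      by (simp add: ln_realpow m_def)
    finally have "ereal ((1/14 / \<epsilon>) ^ n * ln (1 / \<epsilon>)) \<le> ereal (ln (real (m ^ m ^ n)))"
      by simp
    also have "\<dots> \<le> ln_enat (covering_number (usc_fcns n) (aw_dist n) F \<epsilon>)"
      using covering_number_usc_fcns_ge[OF \<epsilon>(1), of n]
      by (intro ln_enat_ge) (simp_all add: F_def m_def)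
    finally show ?thesis .
  qed
  then show "\<exists>F. F \<subseteq> usc_fcns n \<and> Metric_space.mbounded (usc_fcns n) (aw_dist n) F \<and>
      (\<forall>\<epsilon>\<in>{0<..1/49}. ln_enat (covering_number (usc_fcns n) (aw_dist n) F \<epsilon>)
        \<ge> ereal ((1/14 / \<epsilon>) ^ n * ln (1 / \<epsilon>)))"
    using bounded by (intro exI[of _ F]) (auto simp: F_def)
qed auto

end
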